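(* Let $n\geq 3$ be an odd integer. For a nonnegative integer $r$, let $s_{n-1}(r)$ denote the sum of the digits of $r$ in base $n-1$, and for $x\in\mathbb{N}$ define $$S_n(x)=\sum_{0\leq r<x,\; r\equiv 0 \pmod n}(-1)^{s_{n-1}(r)}.$$ For a positive integer $p$ define $$\sigma(n,p)=\sum_{k=1}^{\frac{n-1}{2}}\tan^{2p}\frac{\pi k}{n},$$ and put $x_{n,p}=(n-1)^{2p}$ and $$\lambda=\lambda_n=\frac{\ln\cot\left(\frac{\pi}{2n}\right)}{\ln(n-1)}.$$ Then, as $p\to\infty$, $$S_n(x_{n,p})\sim \frac{2}{n}\,x_{n,p}^{\lambda}\qquad\text{and}\qquad \sigma(n,p)\sim x_{n,p}^{\lambda}.$$
   Context: $n$ is an odd integer with $n\geq 3$. The notation $f(p)\sim g(p)$ means $f(p)/g(p)\to 1$ as $p\to\infty$. *)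

theory Defs
  imports Complex_Main "HOL-Library.Landau_Symbols"
begin

(* The guard b < 2 only serves termination; there the value is 0. *)
fun digit_sum :: "nat \<Rightarrow> nat \<Rightarrow> nat" where
  "digit_sum b r = (if b < 2 \<or> r = 0 then 0 else r mod b + digit_sum b (r div b))"

declare digit_sum.simps [simp del]

definition S :: "nat \<Rightarrow> nat \<Rightarrow> int" where
  "S n x = (\<Sum>r | r < x \<and> n dvd r. (- 1) ^ digit_sum (n - 1) r)"

definition sigma :: "nat \<Rightarrow> nat \<Rightarrow> real" where
  "sigma n p = (\<Sum>k = 1..(n - 1) div 2. tan (pi * real k / real n) ^ (2 * p))"

definition x_np :: "nat \<Rightarrow> nat \<Rightarrow> nat" where
  "x_np n p = (n - 1) ^ (2 * p)"

definition lam :: "nat \<Rightarrow> real" where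
  "lam n = ln (cot (pi / (2 * real n))) / ln (real n - 1)"

end

theory Submission
  imports Defs
begin

text \<open>Put \<open>b = n - 1\<close>, which is even and congruent to \<open>-1\<close> modulo \<open>n\<close>. For an \<open>n\<close>-th root of unity
  \<open>z\<close>, the sum of \<open>(-1) ^ digit_sum b r * z ^ r\<close> over \<open>r < b ^ m\<close> factors over the digits, and the
  factor at position \<open>j\<close> is \<open>(1 - w ^ b) / (1 + w)\<close> with \<open>w = z ^ (b ^ j)\<close>, alternately \<open>z\<close> and
  \<open>1 / z\<close>. Two consecutive factors multiply to \<open>- ((1 - z) / (1 + z))\<^sup>2\<close>, which is the square of
  \<open>tan (pi * k / n)\<close> for \<open>z = cis (2 * pi * k / n)\<close>. Averaging over all \<open>z\<close> selects the multiples
  of \<open>n\<close>, so \<open>S n (x_np n p) = 2 / n * sigma n p\<close> exactly for \<open>p > 0\<close>. Finally, \<open>sigma\<close> is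
  dominated by its largest tangent, \<open>tan (pi / 2 - pi / (2 * n))\<close>.\<close>

lemma digit_sum_mult_add:
  assumes "b \<ge> 2" "d < b"
  shows "digit_sum b (d + q * b) = d + digit_sum b q"
proof (cases "d + q * b = 0")
  case True
  then show ?thesis using assms by (simp add: digit_sum.simps)
next
  case False
  then show ?thesis using assms by (subst digit_sum.simps) auto
qed

text \<open>The cutoff \<open>b ^ m\<close> makes \<open>r\<close> run through all strings of
  \<open>m\<close> base-\<open>b\<close> digits, leading zeros allowed, so the sum can factor over
  the digits.\<close>

definition digit_gf :: "nat \<Rightarrow> nat \<Rightarrow> complex \<Rightarrow> complex" where
  "digit_gf b m z = (\<Sum>r<b ^ m. (- 1) ^ digit_sum b r * z ^ r)"

lemma digit_gf_0 [simp]: "digit_gf b 0 z = 1"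
  by (simp add: digit_gf_def digit_sum.simps)

text \<open>Split off the lowest digit: for \<open>r = d + q * b\<close> the sign is multiplicative,
  so \<open>d\<close> contributes \<open>(- z) ^ d\<close> and \<open>q\<close> sees only
  \<open>z ^ b\<close>.\<close>

lemma digit_gf_Suc:
  assumes "b \<ge> 2"
  shows "digit_gf b (Suc m) z = (\<Sum>d<b. (- z) ^ d) * digit_gf b m (z ^ b)"
proof -
  let ?f = "\<lambda>r. (- 1) ^ digit_sum b r * z ^ r"
  have block: "sum ?f {q * b..<q * b + b} = (\<Sum>d<b. (- z) ^ d) * ((- 1) ^ digit_sum b q * (z ^ b) ^ q)"
    for q
  proof -
    have "sum ?f {q * b..<q * b + b} = (\<Sum>d = 0..<b. ?f (d + q * b))"
      using sum.shift_bounds_nat_ivl[of ?f 0 "q * b" b] by (simp add: add.commute)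
    also have "\<dots> = (\<Sum>d<b. (- z) ^ d * ((- 1) ^ digit_sum b q * (z ^ b) ^ q))"
      unfolding atLeast0LessThan
    proof (rule sum.cong[OF refl])
      fix d assume "d \<in> {..<b}"
      moreover have "(- z) ^ d = (- 1) ^ d * z ^ d"
        by (rule power_minus)
      moreover have "z ^ (q * b) = (z ^ b) ^ q"
        by (simp add: mult.commute flip: power_mult)
      ultimately show "?f (d + q * b) = (- z) ^ d * ((- 1) ^ digit_sum b q * (z ^ b) ^ q)"
        using assms by (simp add: digit_sum_mult_add power_add)
    qed
    finally show ?thesis by (simp add: sum_distrib_right)
  qed
  have "digit_gf b (Suc m) z = sum ?f {..<b ^ m * b}"
    by (simp add: digit_gf_def mult.commute)
  also have "\<dots> = (\<Sum>q<b ^ m. sum ?f {q * b..<q * b + b})"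
    by (rule sum.nat_group[symmetric])
  also have "\<dots> = (\<Sum>d<b. (- z) ^ d) * digit_gf b m (z ^ b)"
    by (simp add: block digit_gf_def sum_distrib_left)
  finally show ?thesis .
qed

lemma alternating_geometric_sum:
  fixes z :: complex
  assumes "even b" "1 + z \<noteq> 0"
  shows "(\<Sum>d<b. (- z) ^ d) = (1 - z ^ b) / (1 + z)"
proof -
  have "(1 - (- z)) * (\<Sum>d<b. (- z) ^ d) = 1 - (- z) ^ b"
    by (rule one_diff_power_eq[symmetric])
  then show ?thesis using assms by (simp add: field_simps)
qed

lemma digit_gf_root_of_unity:
  fixes z :: complex
  assumes b: "b \<ge> 2" "even b" and z: "z ^ Suc b = 1" "1 + z \<noteq> 0"
  shows "digit_gf b (2 * p) z = (- (((1 - z) / (1 + z))\<^sup>2)) ^ p"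
proof (induction p)
  case 0
  show ?case by simp
next
  case (Suc p)
  have z0: "z \<noteq> 0" using z(1) by auto
  \<comment> \<open>Raising to the power \<open>b\<close> inverts \<open>z\<close>, so two digits
    lead back to \<open>z\<close>; hence the induction in steps of two digits.\<close>
  have zb: "z ^ b = 1 / z" using z(1) z0 by (simp add: field_simps)
  have zbb: "(1 / z) ^ b = z"
    using zb z0 by (simp add: power_divide)
  have nz: "1 + 1 / z \<noteq> 0"
    using z z0 by (simp add: field_simps add.commute)
  have "digit_gf b (2 * Suc p) z
      = (1 - 1 / z) / (1 + z) * ((1 - z) / (1 + 1 / z)) * digit_gf b (2 * p) z"
    using b z(2) nz by (simp add: digit_gf_Suc alternating_geometric_sum zb zbb)
  also have "1 + 1 / z = (1 + z) / z" using z0 by (simp add: field_simps)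
  also have "1 - 1 / z = - ((1 - z) / z)" using z0 by (simp add: field_simps)
  also have "- ((1 - z) / z) / (1 + z) * ((1 - z) / ((1 + z) / z)) = - (((1 - z) / (1 + z))\<^sup>2)"
    using z0 z(2) by (simp add: power2_eq_square)
  finally show ?case by (simp add: Suc.IH)
qed

lemma one_plus_cis_double: "1 + cis (2 * t) = 2 * complex_of_real (cos t) * cis t"
  by (simp add: complex_eq_iff cos_double_cos sin_double power2_eq_square)

lemma one_minus_cis_double: "1 - cis (2 * t) = - 2 * \<i> * complex_of_real (sin t) * cis t"
  by (simp add: complex_eq_iff cos_double_sin sin_double power2_eq_square)

text \<open>The common factor \<open>cis t\<close> of numerator and denominator cancels, leaving
  \<open>- \<i> * tan t\<close>; squaring and negating makes this real.\<close>

lemma cayley_cis_double: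
  assumes "cos t \<noteq> 0"
  shows "- (((1 - cis (2 * t)) / (1 + cis (2 * t)))\<^sup>2) = complex_of_real ((tan t)\<^sup>2)"
proof -
  have "(1 - cis (2 * t)) / (1 + cis (2 * t)) = - \<i> * complex_of_real (tan t)"
    unfolding one_plus_cis_double one_minus_cis_double
    using assms by (simp add: tan_def)
  then show ?thesis by (simp add: power_mult_distrib)
qed

text \<open>A zero would give \<open>2 * k = i * n\<close> with \<open>i\<close> and
  \<open>n\<close> both odd. This keeps the denominators \<open>1 + z\<close> away from
  zero.\<close>

lemma cos_rational_pi_nonzero:
  assumes "odd n"
  shows "cos (pi * real k / real n) \<noteq> 0"
proof
  assume "cos (pi * real k / real n) = 0"
  then obtain i :: int where i: "odd i" "pi * real k / real n = real_of_int i * (pi / 2)"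
    unfolding cos_zero_iff_int by auto
  have "n > 0" using assms by (rule odd_pos)
  then have "2 * real k = real_of_int i * real n"
    using i(2) by (simp add: field_simps)
  then have "real_of_int (2 * int k) = real_of_int (i * int n)" by simp
  then have "2 * int k = i * int n" unfolding of_int_eq_iff .
  then have "even (i * int n)" by (metis dvd_triv_left)
  then show False using i(1) assms by simp
qed

lemma roots_of_unity_filter:
  assumes "n > 0"
  shows "(\<Sum>k<n. cis (2 * (pi * real k / real n)) ^ r) = (if n dvd r then of_nat n else 0)"
proof -
  define w where "w = cis (2 * pi * real r / real n)"
  \<comment> \<open>Exchanging the roles of \<open>k\<close> and \<open>r\<close> turns the sum over
    \<open>k\<close> into a geometric sum with ratio \<open>w\<close>.\<close>
  have eq: "cis (2 * (pi * real k / real n)) ^ r = w ^ k" for k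
    by (simp add: w_def Complex.DeMoivre mult_ac)
  have wn: "w ^ n = 1"
    using assms cis_multiple_2pi[of "real r"]
    by (simp add: w_def Complex.DeMoivre)
  have w1: "w = 1 \<longleftrightarrow> n dvd r"
  proof
    assume "w = 1"
    then have "cos (2 * pi * real r / real n) = 1" by (simp add: w_def complex_eq_iff)
    then obtain i :: int where "2 * pi * real r / real n = real_of_int i * 2 * pi"
      unfolding cos_one_2pi_int by auto
    then have "real r = real_of_int i * real n" using assms by (simp add: field_simps)
    then have "real_of_int (int r) = real_of_int (i * int n)" by simp
    then have "int r = i * int n" unfolding of_int_eq_iff .
    then show "n dvd r" by (metis dvd_triv_right int_dvd_int_iff)
  next
    assume "n dvd r"
    then obtain q where "r = n * q" by auto
    then show "w = 1" using assms cis_multiple_2pi[of "real q"] by (simp add: w_def mult.assoc)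
  qed
  show ?thesis
  proof (cases "n dvd r")
    case True
    then show ?thesis using w1 unfolding eq by simp
  next
    case False
    then have "w \<noteq> 1" using w1 by simp
    then have "(\<Sum>k<n. w ^ k) = 0" using wn by (simp add: geometric_sum)
    then show ?thesis using False unfolding eq by simp
  qed
qed

lemma S_eq_tan_sum:
  assumes n: "odd n" "n \<ge> 3"
  shows "real n * real_of_int (S n (x_np n p)) = (\<Sum>k<n. tan (pi * real k / real n) ^ (2 * p))"
proof -
  let ?z = "\<lambda>k. cis (2 * (pi * real k / real n))"
  let ?b = "n - 1"
  have gf: "digit_gf ?b (2 * p) (?z k) = complex_of_real (tan (pi * real k / real n) ^ (2 * p))" for k
  proof -
    note c = cos_rational_pi_nonzero[OF n(1), of k]
    have "?z k ^ Suc ?b = 1"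
      using n cis_multiple_2pi[of "real k"] by (simp add: Complex.DeMoivre mult_ac del: power_Suc)
    moreover have "1 + ?z k \<noteq> 0"
      unfolding one_plus_cis_double using c by simp
    ultimately have "digit_gf ?b (2 * p) (?z k) = (- (((1 - ?z k) / (1 + ?z k))\<^sup>2)) ^ p"
      using n by (intro digit_gf_root_of_unity) auto
    then show ?thesis
      unfolding cayley_cis_double[OF c] by (simp add: power_mult)
  qed
  have "complex_of_real (real n * real_of_int (S n (x_np n p)))
      = (\<Sum>r \<in> {r. r < x_np n p \<and> n dvd r}. (- 1) ^ digit_sum ?b r * of_nat n)"
    by (simp add: S_def sum_distrib_left mult.commute)
  \<comment> \<open>The divisibility condition becomes a weight, which the filter then expands into
    a sum over roots of unity.\<close>
  also have "\<dots> = (\<Sum>r<x_np n p. (- 1) ^ digit_sum ?b r * (if n dvd r then of_nat n else 0))"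
    by (rule sum.mono_neutral_cong_left) auto
  also have "\<dots> = (\<Sum>r<x_np n p. \<Sum>k<n. (- 1) ^ digit_sum ?b r * ?z k ^ r)"
    unfolding sum_distrib_left[symmetric] using n by (subst roots_of_unity_filter) auto
  also have "\<dots> = (\<Sum>k<n. digit_gf ?b (2 * p) (?z k))"
    unfolding digit_gf_def x_np_def by (rule sum.swap)
  also have "\<dots> = complex_of_real (\<Sum>k<n. tan (pi * real k / real n) ^ (2 * p))"
    unfolding gf by simp
  finally show ?thesis unfolding of_real_eq_iff .
qed

text \<open>The even exponent gives \<open>k\<close> and \<open>n - k\<close> equal terms, as
  \<open>tan (pi - t) = - tan t\<close>. The term at \<open>k = 0\<close> vanishes only for
  \<open>p > 0\<close>, since \<open>0 ^ 0 = 1\<close>.\<close>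

lemma tan_sum_eq_sigma:
  assumes n: "odd n" and p: "p > 0"
  shows "(\<Sum>k<n. tan (pi * real k / real n) ^ (2 * p)) = 2 * sigma n p"
proof -
  let ?f = "\<lambda>k. tan (pi * real k / real n) ^ (2 * p)"
  obtain K where K: "n = Suc (2 * K)" using n by (elim oddE) auto
  have refl: "?f (n - k) = ?f k" if "k \<le> n" for k
  proof -
    have "pi * real (n - k) / real n = - (pi * real k / real n) + pi"
      using that K by (simp add: of_nat_diff field_simps)
    then show ?thesis by (simp only: tan_periodic_pi tan_minus) simp
  qed
  have "(\<Sum>k = Suc K..2 * K. ?f k) = (\<Sum>k = 1..K. ?f k)"
    by (rule sum.reindex_bij_witness[of _ "\<lambda>k. n - k" "\<lambda>k. n - k"]) (use K refl in auto)
  moreover have "{..<n} = insert 0 ({1..K} \<union> {Suc K..2 * K})"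
    using K by auto
  then have "(\<Sum>k<n. ?f k) = ?f 0 + ((\<Sum>k = 1..K. ?f k) + (\<Sum>k = Suc K..2 * K. ?f k))"
    by (simp add: sum.union_disjoint ivl_disj_int)
  ultimately show ?thesis using p K by (simp add: sigma_def)
qed

text \<open>\<open>lam n\<close> is the exponent that turns the base \<open>n - 1\<close> into the
  cotangent; positivity of the cotangent lets \<open>exp\<close> undo \<open>ln\<close>.\<close>

lemma x_np_powr_lam:
  assumes n: "n \<ge> 3"
  shows "real (x_np n p) powr lam n = cot (pi / (2 * real n)) ^ (2 * p)"
proof -
  have "0 < pi / (2 * real n)" "pi / (2 * real n) < pi / 2"
    using n by (auto simp: field_simps)
  then have c: "cot (pi / (2 * real n)) > 0"
    by (metis cot_gt_zero)
  have l: "ln (real n - 1) > 0" using n by simp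
  have x: "real (x_np n p) = (real n - 1) ^ (2 * p)" using n by (simp add: x_np_def of_nat_diff)
  have "ln (real (x_np n p)) * lam n = real (2 * p) * ln (cot (pi / (2 * real n)))"
    using l n by (simp add: x lam_def ln_realpow)
  then have "real (x_np n p) powr lam n = exp (real (2 * p) * ln (cot (pi / (2 * real n))))"
    using n by (simp add: x powr_def mult.commute)
  also have "\<dots> = cot (pi / (2 * real n)) ^ (2 * p)"
    using c by (simp only: exp_of_nat_mult exp_ln)
  finally show ?thesis .
qed

text \<open>After division by \<open>f a ^ p\<close>, every term but the one at \<open>a\<close> is
  a power of a ratio of modulus below 1 and tends to 0.\<close>

lemma sum_power_asymp_equiv_dominant:
  fixes f :: "'a \<Rightarrow> real"
  assumes "finite A" "a \<in> A" "f a > 0" "\<And>k. k \<in> A - {a} \<Longrightarrow> \<bar>f k\<bar> < f a"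
  shows "(\<lambda>p. \<Sum>k\<in>A. f k ^ p) \<sim>[at_top] (\<lambda>p. f a ^ p)"
proof (rule asymp_equivI')
  have "(\<lambda>p. (f k / f a) ^ p) \<longlonglongrightarrow> (if k = a then 1 else 0)" if "k \<in> A" for k
    using assms that by (cases "k = a") (auto intro!: LIMSEQ_power_zero)
  then have "(\<lambda>p. \<Sum>k\<in>A. (f k / f a) ^ p) \<longlonglongrightarrow> (\<Sum>k\<in>A. if k = a then 1 else 0)"
    by (intro tendsto_sum)
  then show "(\<lambda>p. (\<Sum>k\<in>A. f k ^ p) / f a ^ p) \<longlonglongrightarrow> 1"
    using assms by (simp add: sum_divide_distrib power_divide)
qed

lemma sigma_asymp_equiv:
  assumes n: "odd n" "n \<ge> 3"
  shows "(\<lambda>p. sigma n p) \<sim>[at_top] (\<lambda>p. cot (pi / (2 * real n)) ^ (2 * p))"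
proof -
  obtain K where K: "n = Suc (2 * K)" using n(1) by (elim oddE) auto
  have K1: "K \<ge> 1" using n K by simp
  let ?t = "\<lambda>k. pi * real k / real n"
  have half: "?t k < pi / 2" if "k \<le> K" for k
  proof -
    have "real k / real n < 1 / 2" using that K by (simp add: field_simps)
    then have "pi * (real k / real n) < pi * (1 / 2)" by (rule mult_strict_left_mono) simp
    then show ?thesis by simp
  qed
  have pos: "0 < tan (?t k)" if "1 \<le> k" "k \<le> K" for k
    using that half[OF that(2)] K by (intro tan_gt_zero) auto
  have less: "tan (?t k) < tan (?t K)" if "1 \<le> k" "k < K" for k
    using that half[of K] K
    by (intro tan_monotone) (auto simp: divide_strict_right_mono intro: less_le_trans[of _ 0])
  \<comment> \<open>As \<open>K\<close> is \<open>(n - 1) / 2\<close>, the largest angle is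
    complementary to \<open>pi / (2 * n)\<close>, so its tangent is the cotangent in
    \<open>lam\<close>.\<close>
  have eq: "?t K = pi / 2 - pi / (2 * real n)"
    using K by (simp add: field_simps)
  have cot: "tan (?t K) = cot (pi / (2 * real n))"
    unfolding eq by (simp add: tan_def cot_def cos_diff sin_diff)
  \<comment> \<open>Squared tangents serve as bases so that the exponent is \<open>p\<close>
    itself.\<close>
  have "(\<lambda>p. \<Sum>k = 1..K. ((tan (?t k))\<^sup>2) ^ p) \<sim>[at_top] (\<lambda>p. ((tan (?t K))\<^sup>2) ^ p)"
  proof (rule sum_power_asymp_equiv_dominant)
    fix k assume "k \<in> {1..K} - {K}"
    then show "\<bar>(tan (?t k))\<^sup>2\<bar> < (tan (?t K))\<^sup>2"
      using less[of k] pos[of k] by (auto intro!: power_strict_mono)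
  qed (use K1 pos[of K] in auto)
  then show ?thesis
    unfolding sigma_def cot power_mult using K by simp
qed

theorem theorem3:
  fixes n :: nat
  assumes "odd n" and "n \<ge> 3"
  shows "(\<lambda>p. real_of_int (S n (x_np n p))) \<sim>[at_top]
           (\<lambda>p. 2 / real n * real (x_np n p) powr lam n)
       \<and> (\<lambda>p. sigma n p) \<sim>[at_top] (\<lambda>p. real (x_np n p) powr lam n)"
proof
  show sigma: "(\<lambda>p. sigma n p) \<sim>[at_top] (\<lambda>p. real (x_np n p) powr lam n)"
    using sigma_asymp_equiv[OF assms] assms(2) by (simp add: x_np_powr_lam)
  have "real_of_int (S n (x_np n p)) = 2 / real n * sigma n p" if "p > 0" for p
    using S_eq_tan_sum[OF assms, of p] tan_sum_eq_sigma[OF assms(1) that] assms(2)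
    by (simp add: field_simps)
  \<comment> \<open>The identity fails at \<open>p = 0\<close>, where the two sides are 1 and
    \<open>(n - 1) / n\<close>; eventual equality is enough.\<close>
  then have "eventually (\<lambda>p. real_of_int (S n (x_np n p)) = 2 / real n * sigma n p) at_top"
    by (intro eventually_mono[OF eventually_gt_at_top[of 0]])
  moreover have "(\<lambda>p. 2 / real n * sigma n p) \<sim>[at_top]
      (\<lambda>p. 2 / real n * real (x_np n p) powr lam n)"
    by (intro asymp_equiv_mult asymp_equiv_refl sigma)
  ultimately show "(\<lambda>p. real_of_int (S n (x_np n p))) \<sim>[at_top]
      (\<lambda>p. 2 / real n * real (x_np n p) powr lam n)"
    by (subst asymp_equiv_cong[OF _ always_eventually]) auto
qed

end
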